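(* Let $C \subseteq \hat{\mathbb{C}}$ be an s-convex set and let $c \in C$ be a point such that $C \subseteq \overline{D}_s(c,\pi/2)$. Then for every real $k$ with $0<k\leqslant 1$, the set $\delta^s_{c,k}(C)$ is s-convex.
   Context: Let $\hat{\mathbb{C}} = \mathbb{C}\cup\{\infty\}$ be the extended complex plane with the spherical metric $2|dz|/(1+|z|^2)$ (curvature $+1$); it is isometric, via stereographic projection, to the unit sphere $\mathbb{S}\subset\mathbb{R}^3$. The spherical distance is $\hat d(z,w) = 2\tan^{-1}\left|\dfrac{z-w}{1+\bar w z}\right|$, with the obvious modifications if one of the points is $\infty$ and with value $\pi$ when $1+\bar w z=0$. Points $u,v\in\hat{\mathbb{C}}$ are antipodal when $v=-1/\bar u$, equivalently $\hat d(u,v)=\pi$. If $u,v$ are distinct and not antipodal, the unique spherical geodesic segment $[u,v]$ joining them is the shorter arc of the unique great circle through them; if $u,v$ are antipodal, the spherical geodesic segments joining them are all the great semicircles with endpoints $u$ and $v$. (Great circles in $\hat{\mathbb{C}}$ are the images of great circles of $\mathbb{S}$ under stereographic projection.) A set $C\subseteq\hat{\mathbb{C}}$ is called spherical convex (s-convex) if for every $u,v\in C$ all spherical geodesic segments joining $u$ and $v$ lie in $C$. The closed hemisphere centred at $a\in\hat{\mathbb{C}}$ is $\overline{D}_s(a,\pi/2)=\{z\in\hat{\mathbb{C}} : \hat d(a,z)\leqslant\pi/2\}$; in particular $\overline{D}_s(0,\pi/2)$ is the closed unit disk. For $c\in\mathbb{C}$ let $\tau_c(z)=\dfrac{z+c}{1-\bar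 c z}$, the spherical isometry taking $0$ to $c$ with positive derivative at $0$ (a rotation of the sphere); for $c=\infty$ take $\tau_\infty(z)=1/z$. The spherical dilation about the origin with factor $k>0$ is $\delta^s_{0,k}(re^{i\theta})=\tan(k\tan^{-1}r)\,e^{i\theta}$, defined at points $z=re^{i\theta}$ with $k\,\hat d(0,z)<\pi$ (so the spherical distance from $0$ is multiplied by $k$ along each geodesic ray from $0$). In particular, for $0<k\leqslant 1$ it is defined on the closed unit disk. The spherical dilation about $c$ with factor $k$ is $\delta^s_{c,k}=\tau_c\circ\delta^s_{0,k}\circ\tau_c^{-1}$; for $0<k\leqslant1$ it is defined on $\overline{D}_s(c,\pi/2)$. *)

theory Defs
  imports "HOL-Analysis.Analysis" "HOL-Analysis.Cross3"
begin

section \<open>The extended complex plane and the unit sphere\<close>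

datatype ecomplex = Fin complex | Infty

text \<open>
  Stereographic projection from the north pole \<open>(0, 0, 1)\<close>, meant for arguments on the unit
  sphere of \<open>\<real>\<^sup>3\<close>. It carries the south pole to \<open>0\<close>, the equator to the unit circle, and the
  standard metric of the sphere to \<open>2 |dz| / (1 + |z|\<^sup>2)\<close>.
\<close>

definition stereo :: "real^3 \<Rightarrow> ecomplex" where
  "stereo x = (if x $ 3 = 1 then Infty
               else Fin (Complex (x $ 1 / (1 - x $ 3)) (x $ 2 / (1 - x $ 3))))"

fun sdist :: "ecomplex \<Rightarrow> ecomplex \<Rightarrow> real" where
  "sdist (Fin z) (Fin w) =
     (if 1 + cnj w * z = 0 then pi else 2 * arctan (cmod ((z - w) / (1 + cnj w * z))))"
| "sdist (Fin z) Infty = (if z = 0 then pi else 2 * arctan (1 / cmod z))"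
| "sdist Infty (Fin w) = (if w = 0 then pi else 2 * arctan (1 / cmod w))"
| "sdist Infty Infty = 0"

definition closed_hemisphere :: "ecomplex \<Rightarrow> ecomplex set" where
  "closed_hemisphere a = {z. sdist a z \<le> pi / 2}"


section \<open>Spherical geodesic segments and spherical convexity\<close>

definition great_circle :: "ecomplex set \<Rightarrow> bool" where
  "great_circle G \<longleftrightarrow> (\<exists>n::real^3. n \<noteq> 0 \<and> G = stereo ` {x \<in> sphere 0 1. n \<bullet> x = 0})"

definition orthonormal_pair :: "real^3 \<Rightarrow> real^3 \<Rightarrow> bool" where
  "orthonormal_pair e f \<longleftrightarrow> norm e = 1 \<and> norm f = 1 \<and> e \<bullet> f = 0"

definition gc_point :: "real^3 \<Rightarrow> real^3 \<Rightarrow> real \<Rightarrow> real^3" where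
  "gc_point e f t = cos t *\<^sub>R e + sin t *\<^sub>R f"

definition great_arc :: "real^3 \<Rightarrow> real^3 \<Rightarrow> real \<Rightarrow> ecomplex set" where
  "great_arc e f L = (\<lambda>t. stereo (gc_point e f t)) ` {0..L}"

text \<open>
  For an orthonormal pair, \<open>t \<mapsto> gc_point e f t\<close> is the unit-speed parametrisation of the great
  circle of the sphere in the plane of \<open>e\<close> and \<open>f\<close>, so \<open>L\<close> below is the length of the arc. The
  bound \<open>L \<le> pi\<close> covers all three cases at once: \<open>0 < L < pi\<close> is the shorter arc between two
  distinct, non-antipodal points, \<open>L = pi\<close> gives all great semicircles between two antipodal
  points, and \<open>L = 0\<close> is the degenerate segment \<open>{u}\<close> when \<open>u = v\<close>.
  See \<open>great_circle_full_arc\<close>, \<open>geodesic_segment_unique\<close> and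
  \<open>geodesic_segment_antipodal\<close> below.
\<close>

definition geodesic_segment :: "ecomplex \<Rightarrow> ecomplex \<Rightarrow> ecomplex set \<Rightarrow> bool" where
  "geodesic_segment u v A \<longleftrightarrow>
     (\<exists>e f L. orthonormal_pair e f \<and> 0 \<le> L \<and> L \<le> pi \<and>
        stereo (gc_point e f 0) = u \<and> stereo (gc_point e f L) = v \<and> A = great_arc e f L)"

definition s_convex :: "ecomplex set \<Rightarrow> bool" where
  "s_convex C \<longleftrightarrow> (\<forall>u\<in>C. \<forall>v\<in>C. \<forall>A. geodesic_segment u v A \<longrightarrow> A \<subseteq> C)"


section \<open>Rotations and spherical dilations\<close>

fun tau :: "ecomplex \<Rightarrow> ecomplex \<Rightarrow> ecomplex" where
  "tau (Fin c) (Fin z) = (if 1 - cnj c * z = 0 then Infty else Fin ((z + c) / (1 - cnj c * z)))"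
| "tau (Fin c) Infty = (if c = 0 then Infty else Fin (- 1 / cnj c))"
| "tau Infty (Fin z) = (if z = 0 then Infty else Fin (1 / z))"
| "tau Infty Infty = Fin 0"

text \<open>
  The dilation is a partial map, defined at finite \<open>z\<close> with \<open>k * sdist (Fin 0) (Fin z) < pi\<close>;
  elsewhere its value is left unspecified.
\<close>

fun sdilation0 :: "real \<Rightarrow> ecomplex \<Rightarrow> ecomplex" where
  "sdilation0 k (Fin z) =
     (if k * sdist (Fin 0) (Fin z) < pi
      then Fin (rcis (tan (k * arctan (cmod z))) (Arg z)) else undefined)"
| "sdilation0 k Infty = undefined"

definition sdilation :: "ecomplex \<Rightarrow> real \<Rightarrow> ecomplex \<Rightarrow> ecomplex" where
  "sdilation c k = tau c \<circ> sdilation0 k \<circ> inv (tau c)"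


section \<open>Consistency of the definitions\<close>

lemma bij_tau: "bij (tau c)"
proof -
  define s where "s = (case c of Fin a \<Rightarrow> tau (Fin (- a)) | Infty \<Rightarrow> tau Infty)"
  have nz: "1 + a * cnj a \<noteq> 0" for a
  proof -
    have "1 + a * cnj a = complex_of_real (1 + (cmod a)\<^sup>2)"
      by (simp only: complex_norm_square of_real_add of_real_1)
    moreover have "1 + (cmod a)\<^sup>2 \<noteq> 0" by (metis add_pos_nonneg less_irrefl zero_le_power2 zero_less_one)
    ultimately show ?thesis by (metis of_real_eq_0_iff)
  qed
  have key: "tau (Fin (- a)) (tau (Fin a) z) = z" for a z
  proof (cases z)
    case (Fin x)
    show ?thesis
    proof (cases "1 - cnj a * x = 0")
      case True
      then have "a \<noteq> 0" by auto
      with True have "x = 1 / cnj a" by (simp add: field_simps)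
      with \<open>a \<noteq> 0\<close> Fin show ?thesis by simp
    next
      case False
      have 1: "1 + cnj a * ((x + a) / (1 - cnj a * x)) = (1 + a * cnj a) / (1 - cnj a * x)"
        using False by (simp add: field_simps)
      have 2: "(x + a) / (1 - cnj a * x) - a = x * (1 + a * cnj a) / (1 - cnj a * x)"
        using False by (simp add: field_simps)
      show ?thesis using False Fin nz[of a] 1 2 by simp
    qed
  next
    case Infty
    then show ?thesis using nz[of a] by (auto simp: field_simps)
  qed
  have inf: "tau Infty (tau Infty z) = z" for z by (cases z) auto
  have key': "tau (Fin a) (tau (Fin (- a)) z) = z" for a z
    using key[of "- a" z] by simp
  have "s (tau c z) = z" "tau c (s z) = z" for z
    by (cases c; simp only: s_def ecomplex.case key key' inf)+
  then show ?thesis by (intro o_bij[of s]) (auto simp: fun_eq_iff)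
qed

definition unstereo :: "ecomplex \<Rightarrow> real^3" where
  "unstereo u = (case u of
     Fin z \<Rightarrow> vector [2 * Re z / (1 + (cmod z)\<^sup>2), 2 * Im z / (1 + (cmod z)\<^sup>2),
                    ((cmod z)\<^sup>2 - 1) / (1 + (cmod z)\<^sup>2)]
   | Infty \<Rightarrow> vector [0, 0, 1])"

lemma pos1: "1 + (cmod z)\<^sup>2 > 0" by (simp add: add_pos_nonneg)

lemma stereo_unstereo: "stereo (unstereo u) = u"
proof (cases u)
  case (Fin z)
  have "1 - ((cmod z)\<^sup>2 - 1) / (1 + (cmod z)\<^sup>2) = 2 / (1 + (cmod z)\<^sup>2)"
    using pos1[of z] by (simp add: field_simps)
  moreover have "((cmod z)\<^sup>2 - 1) / (1 + (cmod z)\<^sup>2) \<noteq> 1"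
    using pos1[of z] by (simp add: field_simps)
  ultimately show ?thesis
    using pos1[of z] Fin by (simp add: unstereo_def stereo_def complex_eq_iff)
qed (simp add: unstereo_def stereo_def)

lemma norm_unstereo: "norm (unstereo u) = 1"
proof (cases u)
  case (Fin z)
  define r where "r = (cmod z)\<^sup>2"
  have r: "(Re z)\<^sup>2 + (Im z)\<^sup>2 = r" by (simp add: r_def cmod_power2)
  have p: "1 + r > 0" using pos1 by (simp add: r_def)
  have "unstereo u \<bullet> unstereo u
      = (4 * ((Re z)\<^sup>2 + (Im z)\<^sup>2) + (r - 1)\<^sup>2) / (1 + r)\<^sup>2"
    unfolding Fin unstereo_def ecomplex.case r_def[symmetric] inner_vec_def
    by (simp add: sum_3 power2_eq_square add_divide_distrib)
  also have "\<dots> = 1" 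
  proof -
    have "4 * r + (r - 1)\<^sup>2 = (1 + r)\<^sup>2" by (simp add: power2_eq_square algebra_simps)
    then show ?thesis unfolding r using p by simp
  qed
  finally show ?thesis by (simp add: norm_eq_1)
qed (simp add: norm_eq_1 unstereo_def inner_vec_def sum_3)

lemma unstereo_stereo:
  assumes "norm x = 1" shows "unstereo (stereo x) = x"
proof -
  have n: "(x$1)\<^sup>2 + (x$2)\<^sup>2 + (x$3)\<^sup>2 = 1"
    using assms by (simp add: norm_eq_1 inner_vec_def sum_3 power2_eq_square)
  show ?thesis
  proof (cases "x $ 3 = 1")
    case True
    then have "x$1 = 0" "x$2 = 0" using n by (auto simp: sum_power2_eq_zero_iff)
    with True show ?thesis by (simp add: stereo_def unstereo_def vec_eq_iff forall_3)
  next
    case False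
    define a where "a = 1 - x$3"
    have a: "a \<noteq> 0" "x$3 = 1 - a" using False by (auto simp: a_def)
    have "(cmod (Complex (x$1/a) (x$2/a)))\<^sup>2 = ((x$1)\<^sup>2 + (x$2)\<^sup>2) / a\<^sup>2"
      by (simp add: cmod_power2 power_divide add_divide_distrib)
    also have "(x$1)\<^sup>2 + (x$2)\<^sup>2 = a * (2 - a)"
      using n a(2) by (simp add: power2_eq_square algebra_simps)
    finally have m: "(cmod (Complex (x$1/a) (x$2/a)))\<^sup>2 = (2 - a) / a"
      using a(1) by (simp add: power2_eq_square)
    have q: "1 + (2 - a) / a = 2 / a" using a(1) by (simp add: field_simps)
    show ?thesis using False a(1)
      by (simp add: stereo_def unstereo_def a_def[symmetric] m q)
        (simp add: vec_eq_iff forall_3 a(2) field_simps)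
  qed
qed

lemma bij_betw_stereo: "bij_betw stereo (sphere 0 1) UNIV"
  by (rule bij_betwI[where g = unstereo]) (auto simp: stereo_unstereo unstereo_stereo norm_unstereo)

lemma sdist_range: "0 \<le> sdist u v" "sdist u v \<le> pi"
proof -
  have "2 * arctan q \<le> pi" for q
    using arctan_ubound[of q] by linarith
  then show "0 \<le> sdist u v" "sdist u v \<le> pi"
    by (cases u; cases v; simp)+
qed

lemma cos_two_arctan: "cos (2 * arctan q) = (1 - q\<^sup>2) / (1 + q\<^sup>2)"
proof -
  have "1 + q\<^sup>2 > 0" by (simp add: add_pos_nonneg)
  moreover have "cos (2 * arctan q) = 2 * (1 / sqrt (1 + q\<^sup>2))\<^sup>2 - 1"
    by (simp only: cos_double_cos cos_arctan)
  ultimately show ?thesis by (simp add: power_divide field_simps)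
qed

lemma cos_sdist: "cos (sdist u v) = unstereo u \<bullet> unstereo v"
proof -
  have fin: "cos (sdist (Fin z) (Fin w)) = unstereo (Fin z) \<bullet> unstereo (Fin w)" for z w
  proof -
    define D where "D = (cmod (1 + cnj w * z))\<^sup>2"
    define N where "N = (cmod (z - w))\<^sup>2"
    have p: "(1 + (cmod z)\<^sup>2) * (1 + (cmod w)\<^sup>2) > 0"
      using pos1 by (meson mult_pos_pos)
    have s: "D + N = (1 + (cmod z)\<^sup>2) * (1 + (cmod w)\<^sup>2)"
      unfolding D_def N_def cmod_power2 by (simp add: power2_eq_square algebra_simps)
    have d: "D - N = (1 - (cmod z)\<^sup>2) * (1 - (cmod w)\<^sup>2) + 4 * (Re z * Re w + Im z * Im w)"
      unfolding D_def N_def cmod_power2 by (simp add: power2_eq_square algebra_simps)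
    have "cos (sdist (Fin z) (Fin w)) = (D - N) / (D + N)"
    proof (cases "1 + cnj w * z = 0")
      case True
      then have "D = 0" by (simp add: D_def)
      with s p have "N > 0" by simp
      then show ?thesis using True \<open>D = 0\<close> by simp
    next
      case False
      then have "D > 0" "D + N > 0" by (auto simp: D_def N_def add_pos_nonneg)
      moreover have "(cmod ((z - w) / (1 + cnj w * z)))\<^sup>2 = N / D"
        by (simp add: D_def N_def norm_divide power_divide)
      moreover have "(1 - N / D) / (1 + N / D) = (D - N) / (D + N)"
        using \<open>D > 0\<close> \<open>D + N > 0\<close> by (simp add: divide_simps)
      ultimately show ?thesis using False by (simp only: sdist.simps if_False cos_two_arctan)
    qed
    also have "\<dots> = unstereo (Fin z) \<bullet> unstereo (Fin w)"
      unfolding s d using pos1[of z] pos1[of w]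
      by (simp add: unstereo_def inner_vec_def sum_3 divide_simps) (simp add: algebra_simps)
    finally show ?thesis .
  qed
  have inf: "cos (sdist Infty (Fin w)) = unstereo Infty \<bullet> unstereo (Fin w)" for w
  proof (cases "w = 0")
    case False
    then show ?thesis using pos1[of w]
      by (simp add: unstereo_def inner_vec_def sum_3 cos_two_arctan power_divide divide_simps)
  qed (simp add: unstereo_def inner_vec_def sum_3)
  have sym: "sdist (Fin w) Infty = sdist Infty (Fin w)" for w by simp
  have ii: "cos (sdist Infty Infty) = unstereo Infty \<bullet> unstereo Infty"
    by (simp add: unstereo_def inner_vec_def sum_3)
  show ?thesis
    by (cases u; cases v) (simp_all only: fin inf sym ii inner_commute)
qed

lemma sdist_stereo:
  assumes "norm x = 1" "norm y = 1"
  shows "sdist (stereo x) (stereo y) = arccos (x \<bullet> y)"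
  using cos_sdist[of "stereo x" "stereo y"] assms sdist_range[of "stereo x" "stereo y"]
  by (metis arccos_cos unstereo_stereo)

lemma norm_gc_point: "orthonormal_pair e f \<Longrightarrow> norm (gc_point e f t) = 1"
  unfolding norm_eq_1 gc_point_def orthonormal_pair_def
  by (simp add: inner_add_left inner_add_right inner_commute[of f e] power2_eq_square[symmetric])

lemma inner_gc_point: "orthonormal_pair e f \<Longrightarrow> gc_point e f 0 \<bullet> gc_point e f t = cos t"
  by (simp add: gc_point_def orthonormal_pair_def norm_eq_1 inner_add_right)

lemma great_arc_length:
  assumes "orthonormal_pair e f" "0 \<le> L" "L \<le> pi"
  shows "sdist (stereo (gc_point e f 0)) (stereo (gc_point e f L)) = L"
  using assms by (simp add: sdist_stereo norm_gc_point inner_gc_point arccos_cos)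

lemma great_circle_full_arc:
  assumes "orthonormal_pair e f"
  shows "great_arc e f (2 * pi) = stereo ` {x \<in> sphere 0 1. cross3 e f \<bullet> x = 0}"
    and "great_circle (great_arc e f (2 * pi))"
proof -
  have o: "e \<bullet> e = 1" "f \<bullet> f = 1" "e \<bullet> f = 0" "f \<bullet> e = 0"
    using assms by (auto simp: orthonormal_pair_def norm_eq_1 inner_commute)
  define n where "n = cross3 e f"
  have nn: "(norm n)\<^sup>2 = 1"
    using norm_cross[of e f] assms by (simp add: n_def orthonormal_pair_def)
  have "x \<in> gc_point e f ` {0..2*pi}" if x: "norm x = 1" "n \<bullet> x = 0" for x
  proof -
    define y where "y = x - (x \<bullet> e) *\<^sub>R e - (x \<bullet> f) *\<^sub>R f"
    have "y \<bullet> e = 0" "y \<bullet> f = 0" by (simp_all add: y_def inner_diff_left o)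
    moreover have ny: "n \<bullet> y = 0"
      using x(2) by (simp add: y_def inner_diff_right n_def dot_cross_self)
    ultimately have "cross3 n y = 0"
      using Lagrange[of y e f] cross_skew[of n y] by (simp add: n_def)
    then have "y = 0" using norm_cross_dot[of n y] ny nn by auto
    then have xe: "x = (x \<bullet> e) *\<^sub>R e + (x \<bullet> f) *\<^sub>R f" by (simp add: y_def algebra_simps)
    have "x \<bullet> x = (x \<bullet> e)\<^sup>2 + (x \<bullet> f)\<^sup>2"
      by (subst (2) xe) (simp add: inner_add_right power2_eq_square)
    then have "(x \<bullet> e)\<^sup>2 + (x \<bullet> f)\<^sup>2 = 1" using x(1) by (simp add: norm_eq_1)
    then obtain t where "0 \<le> t" "t < 2 * pi" "x \<bullet> e = cos t" "x \<bullet> f = sin t"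
      using sincos_total_2pi by metis
    then show ?thesis using xe by (auto simp: gc_point_def intro!: image_eqI[where x = t])
  qed
  then have "gc_point e f ` {0..2*pi} = {x \<in> sphere 0 1. n \<bullet> x = 0}"
    using norm_gc_point[OF assms]
    by (auto simp: gc_point_def n_def inner_add_right dot_cross_self)
  then show *: "great_arc e f (2 * pi) = stereo ` {x \<in> sphere 0 1. cross3 e f \<bullet> x = 0}"
    by (simp add: great_arc_def n_def image_image[symmetric])
  have "cross3 e f \<noteq> 0" using nn by (auto simp: n_def)
  with * show "great_circle (great_arc e f (2 * pi))" by (auto simp: great_circle_def)
qed

lemma ex_orthonormal_pair:
  assumes "norm (e::real^3) = 1" obtains f where "orthonormal_pair e f"
proof -
  obtain g :: "real^3" where "g \<noteq> 0" "orthogonal e g"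
    using orthogonal_to_vector_exists[of e] by auto
  then have "orthonormal_pair e (g /\<^sub>R norm g)"
    using assms by (simp add: orthonormal_pair_def orthogonal_def)
  then show ?thesis by (rule that)
qed

lemma geodesic_segment_unique:
  assumes "sdist u v < pi"
  shows "\<exists>!A. geodesic_segment u v A"
proof -
  define L where "L = sdist u v"
  have L: "0 \<le> L" "L < pi" using assms sdist_range by (auto simp: L_def)
  have cL: "cos L = unstereo u \<bullet> unstereo v" by (simp add: L_def cos_sdist)
  have nu: "unstereo u \<bullet> unstereo u = 1" "unstereo v \<bullet> unstereo v = 1"
    using norm_unstereo by (simp_all add: norm_eq_1)
  have par: "e = unstereo u \<and> M = L \<and> gc_point e f L = unstereo v"
    if "orthonormal_pair e f" "0 \<le> M" "M \<le> pi"
      "stereo (gc_point e f 0) = u" "stereo (gc_point e f M) = v" for e f M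
  proof -
    have "M = L" using great_arc_length[OF that(1-3)] that(4,5) by (simp add: L_def)
    moreover have "e = unstereo u" "gc_point e f M = unstereo v"
      using that norm_gc_point unstereo_stereo
      by (auto simp: gc_point_def orthonormal_pair_def)
    ultimately show ?thesis by simp
  qed
  show ?thesis
  proof (cases "L = 0")
    case True
    obtain f where f: "orthonormal_pair (unstereo u) f"
      using ex_orthonormal_pair norm_unstereo by metis
    have "norm (unstereo u - unstereo v) = 0"
      using nu cL True by (simp add: norm_eq_sqrt_inner inner_diff_left inner_diff_right inner_commute)
    then have "u = v" by (metis eq_iff_diff_eq_0 norm_eq_zero stereo_unstereo)
    then have ex: "geodesic_segment u v {u}"
      unfolding geodesic_segment_def
      using f by (intro exI[of _ "unstereo u"] exI[of _ f] exI[of _ 0])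
        (auto simp: great_arc_def gc_point_def stereo_unstereo)
    have "A = {u}" if A: "geodesic_segment u v A" for A
    proof -
      obtain e f M where *: "orthonormal_pair e f" "0 \<le> M" "M \<le> pi"
        "stereo (gc_point e f 0) = u" "stereo (gc_point e f M) = v" "A = great_arc e f M"
        using A unfolding geodesic_segment_def by auto
      have "M = 0" using par[OF *(1-5)] True by simp
      then show ?thesis using * by (simp add: great_arc_def)
    qed
    with ex show ?thesis by blast
  next
    case False
    then have s: "sin L > 0" using L by (simp add: sin_gt_zero)
    define g where "g = (unstereo v - cos L *\<^sub>R unstereo u) /\<^sub>R sin L"
    have "(unstereo v - cos L *\<^sub>R unstereo u) \<bullet> (unstereo v - cos L *\<^sub>R unstereo u) = 1 - (cos L)\<^sup>2"
      using nu by (simp add: inner_diff_left inner_diff_right cL inner_commute power2_eq_square)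
    also have "\<dots> = (sin L)\<^sup>2" by (simp add: sin_squared_eq)
    finally have "g \<bullet> g = 1" using s
      by (simp only: g_def inner_scaleR_left inner_scaleR_right) (simp add: power2_eq_square field_simps)
    moreover have "unstereo u \<bullet> g = 0"
      using nu by (simp add: g_def inner_diff_right cL)
    ultimately have "orthonormal_pair (unstereo u) g"
      using norm_unstereo by (simp add: orthonormal_pair_def norm_eq_1)
    then have ex: "geodesic_segment u v (great_arc (unstereo u) g L)"
      unfolding geodesic_segment_def using L s
      by (intro exI[of _ "unstereo u"] exI[of _ g] exI[of _ L])
        (simp add: gc_point_def stereo_unstereo g_def)
    have "A = great_arc (unstereo u) g L" if A: "geodesic_segment u v A" for A
    proof -
      obtain e f M where *: "orthonormal_pair e f" "0 \<le> M" "M \<le> pi"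
        "stereo (gc_point e f 0) = u" "stereo (gc_point e f M) = v" "A = great_arc e f M"
        using A unfolding geodesic_segment_def by auto
      have e: "e = unstereo u" "M = L" "gc_point e f L = unstereo v" using par[OF *(1-5)] by auto
      have "sin L *\<^sub>R f = unstereo v - cos L *\<^sub>R unstereo u"
        using e by (simp add: gc_point_def algebra_simps)
      then have "f = g" using s by (metis g_def scaleR_scaleR left_inverse scaleR_one less_irrefl)
      then show ?thesis using e * by simp
    qed
    with ex show ?thesis by blast
  qed
qed

lemma geodesic_segment_antipodal:
  assumes "sdist u v = pi"
  shows "geodesic_segment u v A \<longleftrightarrow>
    (\<exists>e f. orthonormal_pair e f \<and> stereo e = u \<and> stereo (- e) = v \<and> A = great_arc e f pi)"
proof
  assume "geodesic_segment u v A"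
  then obtain e f L where *: "orthonormal_pair e f" "0 \<le> L" "L \<le> pi"
    "stereo (gc_point e f 0) = u" "stereo (gc_point e f L) = v" "A = great_arc e f L"
    unfolding geodesic_segment_def by auto
  have "L = pi" using great_arc_length[OF *(1-3)] *(4,5) assms by simp
  with * show "\<exists>e f. orthonormal_pair e f \<and> stereo e = u \<and> stereo (- e) = v \<and> A = great_arc e f pi"
    by (intro exI[of _ e] exI[of _ f]) (simp add: gc_point_def)
next
  assume "\<exists>e f. orthonormal_pair e f \<and> stereo e = u \<and> stereo (- e) = v \<and> A = great_arc e f pi"
  then obtain e f where "orthonormal_pair e f" "stereo e = u" "stereo (- e) = v" "A = great_arc e f pi"
    by auto
  then show "geodesic_segment u v A"
    unfolding geodesic_segment_def
    by (intro exI[of _ e] exI[of _ f] exI[of _ pi]) (simp add: gc_point_def)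
qed

end

theory Submission
  imports Defs
begin

text \<open>
  Work on the unit sphere, with \<open>p\<close> the point corresponding to \<open>c\<close>; convexity of \<open>S\<close> means being
  closed under nonnegative combinations of unit length. Let \<open>D\<close> be the dilation, \<open>x, y \<in> S\<close>, and
  \<open>w = s D x + t D y\<close> a unit vector with \<open>s, t \<ge> 0\<close>. Its preimage \<open>D\<inverse> w\<close> is a combination of
  \<open>x\<close>, \<open>y\<close> and \<open>p\<close>, with the coefficients of \<open>x\<close> and \<open>y\<close> read off from the components orthogonal
  to \<open>p\<close>. As \<open>p \<in> S\<close>, it suffices that the coefficient of \<open>p\<close> is nonnegative. In the
  coordinate \<open>q = tan \<theta>\<close> of the gnomonic projection at \<open>p\<close>, where \<open>\<theta>\<close> is the angle to \<open>p\<close>, this is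
  the statement that \<open>q cot (arctan q / k)\<close> is decreasing and concave.
\<close>

section \<open>The radial profile\<close>

text \<open>The right side minus the left has derivative
  \<open>(1 - k\<^sup>2) * (sin (k * y) * sin y)\<close>. For \<open>x < pi / 2\<close> this is
  \<open>tan (k * x) \<le> k * tan x\<close>; cleared of denominators it also covers
  \<open>x = pi / 2\<close>. It yields concavity of the profile.\<close>

lemma sin_scaled_cos_le:
  fixes k x :: real
  assumes "0 < k" "k \<le> 1" "0 \<le> x" "x \<le> pi"
  shows "sin (k * x) * cos x \<le> k * cos (k * x) * sin x"
proof -
  define g where "g y = k * cos (k * y) * sin y - sin (k * y) * cos y" for y
  have "g 0 \<le> g x"
  proof (rule DERIV_nonneg_imp_nondecreasing[OF assms(3)])
    fix y assume y: "0 \<le> y" "y \<le> x"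
    have "(g has_real_derivative (1 - k\<^sup>2) * (sin (k * y) * sin y)) (at y)"
      unfolding g_def by (auto intro!: derivative_eq_intros simp: algebra_simps power2_eq_square)
    moreover have "k * y \<le> y" using assms y by (simp add: mult_left_le_one_le)
    then have "0 \<le> (1 - k\<^sup>2) * (sin (k * y) * sin y)"
      using assms y by (intro mult_nonneg_nonneg sin_ge_zero) (auto simp: power_le_one)
    ultimately show "\<exists>d. (g has_real_derivative d) (at y) \<and> 0 \<le> d" by blast
  qed
  then show ?thesis by (simp add: g_def)
qed

text \<open>Since \<open>cos\<close> decreases on \<open>[0, pi]\<close>, the difference of the
  sides has nonnegative derivative. Applied at a doubled angle, this makes the profile
  decreasing.\<close>

lemma scaled_sin_le:
  fixes k x :: real
  assumes "0 < k" "k \<le> 1" "0 \<le> x" "x \<le> pi"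
  shows "k * sin x \<le> sin (k * x)"
proof -
  define g where "g y = sin (k * y) - k * sin y" for y
  have "g 0 \<le> g x"
  proof (rule DERIV_nonneg_imp_nondecreasing[OF assms(3)])
    fix y assume y: "0 \<le> y" "y \<le> x"
    have "(g has_real_derivative k * (cos (k * y) - cos y)) (at y)"
      unfolding g_def by (auto intro!: derivative_eq_intros simp: algebra_simps)
    moreover have "k * y \<le> y" using assms y by (simp add: mult_left_le_one_le)
    then have "cos y \<le> cos (k * y)" using assms y by (intro cos_monotone_0_pi_le) auto
    ultimately show "\<exists>d. (g has_real_derivative d) (at y) \<and> 0 \<le> d"
      using assms by (metis diff_ge_0_iff_ge less_imp_le mult_nonneg_nonneg)
  qed
  then show ?thesis by (simp add: g_def)
qed

text \<open>For \<open>q > 0\<close>, a dilated point is a multiple of \<open>p + q u\<close>, with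
  \<open>u\<close> a unit vector orthogonal to \<open>p\<close>. The multiple of its preimage with
  the same orthogonal part \<open>q u\<close> has this coefficient of \<open>p\<close>.\<close>

definition dilation_profile :: "real \<Rightarrow> real \<Rightarrow> real" where
  "dilation_profile k q = q * cot (arctan q / k)"

lemma dilation_profile_tan:
  assumes "\<bar>x\<bar> < pi / 2"
  shows "dilation_profile k (tan x) = tan x * cot (x / k)"
  using assms by (simp add: dilation_profile_def arctan_tan abs_less_iff)

context
  fixes k :: real
  assumes k: "0 < k" "k < 1"
begin

text \<open>\<open>tan (k * pi / 2)\<close> is the gnomonic radius of the dilated closed hemisphere,
  finite because \<open>k < 1\<close>.\<close>

lemma arctan_scaled_bounds:
  assumes "0 < q" "q \<le> tan (k * pi / 2)"
  shows "0 < arctan q / k" "arctan q / k \<le> pi / 2"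
proof -
  have kpi: "0 < k * pi" "k * pi < pi" using k by simp_all
  have "arctan q \<le> arctan (tan (k * pi / 2))" using assms by (simp add: arctan_le_iff)
  also have "\<dots> = k * pi / 2"
    by (rule arctan_tan; use kpi in linarith)
  finally show "arctan q / k \<le> pi / 2" using k by (simp add: field_simps)
  show "0 < arctan q / k" using assms k by simp
qed

text \<open>With \<open>x = arctan q / k\<close>, so that \<open>q = tan (k * x)\<close>, the signs
  of the first and second derivatives come from \<open>scaled_sin_le\<close> and
  \<open>sin_scaled_cos_le\<close>. The point \<open>0\<close> is left out because the convention
  \<open>cot 0 = 0\<close> makes the profile jump there.\<close>

lemma
  shows dilation_profile_antimono:
      "\<lbrakk>0 < x; x \<le> y; y \<le> tan (k * pi / 2)\<rbrakk> \<Longrightarrow> dilation_profile k y \<le> dilation_profile k x"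
    and dilation_profile_concave: "concave_on {0<..tan (k * pi / 2)} (dilation_profile k)"
proof -
  define f' where "f' q = cot (arctan q / k) - q / (k * (1 + q\<^sup>2) * (sin (arctan q / k))\<^sup>2)" for q
  define f'' where "f'' q = 2 * (q * cot (arctan q / k) / k - 1) /
      (k * (1 + q\<^sup>2)\<^sup>2 * (sin (arctan q / k))\<^sup>2)" for q
  have s: "sin (arctan q / k) > 0" if "0 < q" "q \<le> tan (k * pi / 2)" for q
    using arctan_scaled_bounds[OF that] pi_gt_zero by (intro sin_gt_zero; linarith)
  have p: "1 + q\<^sup>2 > 0" for q :: real by (simp add: add_pos_nonneg)
  have tk: "q = sin (k * (arctan q / k)) / cos (k * (arctan q / k))" "cos (k * (arctan q / k)) > 0" for q
    using k tan_arctan[of q] cos_gt_zero_pi[OF arctan_lbound arctan_ubound, of q]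
    by (simp_all add: tan_def)
  have da: "((\<lambda>q. arctan q / k) has_real_derivative 1 / (k * (1 + q\<^sup>2))) (at q)" for q
    using k p[of q] by (auto intro!: derivative_eq_intros simp: divide_simps)
  have dc: "((\<lambda>q. cot (arctan q / k)) has_real_derivative
      - 1 / (k * (1 + q\<^sup>2) * (sin (arctan q / k))\<^sup>2)) (at q)"
    if q: "0 < q" "q \<le> tan (k * pi / 2)" for q
  proof -
    from DERIV_chain2[OF DERIV_cot da] show ?thesis
      using s[OF q] k p[of q] by (simp add: field_simps)
  qed
  have d1: "(dilation_profile k has_real_derivative f' q) (at q)"
    if "0 < q" "q \<le> tan (k * pi / 2)" for q
    unfolding dilation_profile_def[abs_def] f'_def
    using DERIV_mult[OF DERIV_ident dc[OF that]] by simp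
  have d2: "(f' has_real_derivative f'' q) (at q)"
    if q: "0 < q" "q \<le> tan (k * pi / 2)" for q
  proof -
    have "((\<lambda>q. k * (1 + q\<^sup>2) * (sin (arctan q / k))\<^sup>2) has_real_derivative
        2 * k * q * (sin (arctan q / k))\<^sup>2 + 2 * sin (arctan q / k) * cos (arctan q / k)) (at q)"
    proof -
      define m where "m = k * (1 + q\<^sup>2)"
      have "m \<noteq> 0" using k p[of q] by (simp add: m_def)
      have "((\<lambda>q. k * (1 + q\<^sup>2)) has_real_derivative 2 * k * q) (at q)"
        by (auto intro!: derivative_eq_intros)
      note DERIV_mult[OF this DERIV_power[OF DERIV_chain2[OF DERIV_sin da], of 2]]
      then show ?thesis
        unfolding m_def[symmetric] using \<open>m \<noteq> 0\<close> by (simp add: mult_ac)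
    qed
    note D = DERIV_divide[OF DERIV_ident this]
    have D: "(f' has_real_derivative
        - 1 / (k * (1 + q\<^sup>2) * (sin (arctan q / k))\<^sup>2)
        - (1 * (k * (1 + q\<^sup>2) * (sin (arctan q / k))\<^sup>2)
           - q * (2 * k * q * (sin (arctan q / k))\<^sup>2 + 2 * sin (arctan q / k) * cos (arctan q / k)))
          / ((k * (1 + q\<^sup>2) * (sin (arctan q / k))\<^sup>2) * (k * (1 + q\<^sup>2) * (sin (arctan q / k))\<^sup>2))) (at q)"
      unfolding f'_def[abs_def] using k s[OF q] p[of q] by (intro DERIV_diff[OF dc[OF q] D]) simp
    \<comment> \<open>Replacing sine and cosine by \<open>r\<close> and \<open>c\<close> leaves a
      rational identity, which rests on \<open>u - q\<^sup>2 = 1\<close>.\<close>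
    have *: "- 1 / (k * u * r\<^sup>2)
        - (1 * (k * u * r\<^sup>2) - q * (2 * k * q * r\<^sup>2 + 2 * r * c)) / ((k * u * r\<^sup>2) * (k * u * r\<^sup>2))
        = 2 * (q * (c / r) / k - 1) / (k * u\<^sup>2 * r\<^sup>2)"
      if "u = 1 + q\<^sup>2" "u > 0" "r > 0" for u r c
    proof -
      have u: "u = 1 + q * q" using that by (simp add: power2_eq_square)
      show ?thesis using k that(2,3)
        by (simp add: divide_simps power2_eq_square) (simp add: algebra_simps u)
    qed
    show ?thesis
      unfolding f''_def cot_def
      by (rule DERIV_cong[OF D]) (rule *[OF refl p s[OF q]])
  qed
  have neg: "f' q \<le> 0" if q: "0 < q" "q \<le> tan (k * pi / 2)" for q
  proof -
    define x where "x = arctan q / k"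
    have x: "sin x > 0" "q = sin (k * x) / cos (k * x)" "cos (k * x) > 0"
      using s[OF q] tk[of q] unfolding x_def by blast+
    \<comment> \<open>The doubled angle is still at most \<open>pi\<close>, and
      \<open>sin (k * x) * cos (k * x)\<close> is rational in \<open>q\<close>.\<close>
    have "k * sin (2 * x) \<le> sin (k * (2 * x))"
      using arctan_scaled_bounds[OF q, folded x_def] k by (intro scaled_sin_le) linarith+
    then have "k * (sin x * cos x) \<le> sin (k * x) * cos (k * x)"
      using sin_double[of x] sin_double[of "k * x"] by (simp add: mult.left_commute)
    also have "\<dots> = q / (1 + q\<^sup>2)"
    proof -
      have "(1 + q\<^sup>2) * (cos (k * x))\<^sup>2 = 1"
        using x(3) sin_cos_squared_add[of "k * x"] by (simp add: x(2) power_divide field_simps)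
      then have "(cos (k * x))\<^sup>2 = 1 / (1 + q\<^sup>2)"
        using p[of q] by (simp add: eq_divide_eq mult.commute)
      moreover have "q * (cos (k * x))\<^sup>2 = sin (k * x) * cos (k * x)"
        using x(3) by (simp add: x(2) power2_eq_square)
      ultimately show ?thesis by simp
    qed
    finally have "k * (sin x * cos x) \<le> q / (1 + q\<^sup>2)" .
    then have "cos x / sin x \<le> q / (k * (1 + q\<^sup>2) * (sin x)\<^sup>2)"
      using k p[of q] x(1) by (simp add: divide_simps power2_eq_square) (simp add: algebra_simps)
    then show ?thesis by (simp add: f'_def cot_def x_def)
  qed
  show "\<lbrakk>0 < x; x \<le> y; y \<le> tan (k * pi / 2)\<rbrakk> \<Longrightarrow> dilation_profile k y \<le> dilation_profile k x"
    by (erule DERIV_nonpos_imp_nonincreasing[of x y]) (meson neg d1 order.strict_trans2 order.trans)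
  have "f'' q \<le> 0" if q: "0 < q" "q \<le> tan (k * pi / 2)" for q
  proof -
    define x where "x = arctan q / k"
    have x: "q = sin (k * x) / cos (k * x)" "cos (k * x) > 0"
      using tk[of q] unfolding x_def by blast+
    have "sin (k * x) * cos x \<le> k * cos (k * x) * sin x"
      using arctan_scaled_bounds[OF q, folded x_def] k pi_gt_zero
      by (intro sin_scaled_cos_le) linarith+
    then have "q * cos x \<le> k * sin x"
      unfolding x(1) using x(2) by (simp add: field_simps)
    then have "q * cos (arctan q / k) \<le> k * sin (arctan q / k)"
      unfolding x_def .
    then have "q * cot (arctan q / k) / k \<le> 1" using s[OF q] k by (simp add: cot_def field_simps)
    then have "q * cot (arctan q / k) / k - 1 \<le> 0" by (simp only: diff_le_0_iff_le)
    then have "2 * (q * cot (arctan q / k) / k - 1) \<le> 0" by (rule mult_nonneg_nonpos[rotated]) simp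
    then show ?thesis
      unfolding f''_def by (rule divide_nonpos_nonneg) (use k in simp)
  qed
  then show "concave_on {0<..tan (k * pi / 2)} (dilation_profile k)"
    using d1 d2 by (intro f''_le0_imp_concave[where f' = f' and f'' = f'']) auto
qed

text \<open>The junk value \<open>cot 0 = 0\<close> makes the profile vanish at \<open>0\<close>, below its limit \<open>k\<close>; this only
  weakens the inequality.\<close>

lemma dilation_profile_combination:
  assumes "0 \<le> x" "x \<le> tan (k * pi / 2)" "0 \<le> y" "y \<le> tan (k * pi / 2)"
    and "0 \<le> a" "0 \<le> b" "a + b = 1" and "0 < z" "z \<le> a * x + b * y"
  shows "a * dilation_profile k x + b * dilation_profile k y \<le> dilation_profile k z"
proof -
  \<comment> \<open>For the cases where one coordinate is \<open>0\<close> and its term vanishes: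
    the remaining value is nonnegative, so the weight \<open>b \<le> 1\<close> only shrinks
    it.\<close>
  have one: "b * dilation_profile k y \<le> dilation_profile k z"
    if y: "0 < y" "y \<le> tan (k * pi / 2)" and b: "0 \<le> b" "b \<le> 1" "z \<le> b * y" for b y
  proof -
    have "z \<le> y" using b y mult_left_le_one_le[of y b] by linarith
    then have "dilation_profile k y \<le> dilation_profile k z"
      using dilation_profile_antimono assms(8) y by blast
    moreover have "0 \<le> cos (arctan y / k)" "0 \<le> sin (arctan y / k)"
      using arctan_scaled_bounds[OF y] pi_gt_zero by (intro cos_ge_zero sin_ge_zero; linarith)+
    then have "0 \<le> dilation_profile k y"
      using y(1) by (simp add: dilation_profile_def cot_def)
    ultimately show ?thesis using b mult_left_le_one_le[of "dilation_profile k y" b] by linarith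
  qed
  have f0: "dilation_profile k 0 = 0" by (simp add: dilation_profile_def)
  consider "x = 0" "y = 0" | "x = 0" "y > 0" | "x > 0" "y = 0" | "x > 0" "y > 0"
    using assms by linarith
  then show ?thesis
  proof cases
    case 1
    then show ?thesis using assms by simp
  next
    case 2
    then show ?thesis using one[of y b] assms f0 by simp
  next
    case 3
    then show ?thesis using one[of x a] assms f0 by simp
  next
    case 4
    have "a * dilation_profile k x + b * dilation_profile k y \<le> dilation_profile k (a * x + b * y)"
      using dilation_profile_concave 4 assms unfolding concave_on_iff by simp
    also have "\<dots> \<le> dilation_profile k z"
      using 4 assms convex_bound_le[of x "tan (k * pi / 2)" y a b]
      by (intro dilation_profile_antimono) auto
    finally show ?thesis .
  qed
qed

end

section \<open>Dilations as maps of the unit sphere\<close>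

text \<open>Homogeneous coordinates turn \<open>tau c\<close> into a linear map without exceptional points.\<close>

definition homogeneous :: "ecomplex \<Rightarrow> complex \<Rightarrow> complex \<Rightarrow> bool" where
  "homogeneous u a b \<longleftrightarrow> (a \<noteq> 0 \<or> b \<noteq> 0) \<and> u = (if b = 0 then Infty else Fin (a / b))"

lemma ex_homogeneous: obtains a b where "homogeneous u a b"
  by (cases u) (auto simp: homogeneous_def intro: that[of _ 1] that[of 1 0])

text \<open>Points of the sphere are lines in complex 2-space, and the angle between points is twice
  the Hermitian angle between lines; the formula is
  \<open>cos (2 * t) = 2 * (cos t)\<^sup>2 - 1\<close>.\<close>

lemma unstereo_inner_homogeneous:
  assumes "homogeneous u a b" "homogeneous v a' b'"
  shows "unstereo u \<bullet> unstereo v =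
    2 * (cmod (a * cnj a' + b * cnj b'))\<^sup>2 /
      (((cmod a)\<^sup>2 + (cmod b)\<^sup>2) * ((cmod a')\<^sup>2 + (cmod b')\<^sup>2)) - 1"
proof -
  \<comment> \<open>The Hopf map, which treats \<open>Infty\<close> (\<open>y = 0\<close>) and
    finite points by one formula.\<close>
  have un: "unstereo w = (1 / ((cmod x)\<^sup>2 + (cmod y)\<^sup>2)) *\<^sub>R
      vector [2 * Re (x * cnj y), 2 * Im (x * cnj y), (cmod x)\<^sup>2 - (cmod y)\<^sup>2]"
    if "homogeneous w x y" for w x y
  proof (cases "y = 0")
    case True
    then show ?thesis using that
      by (simp add: homogeneous_def unstereo_def vec_eq_iff forall_3)
  next
    case False
    define n where "n = (cmod y)\<^sup>2"
    have n: "n > 0" using False by (simp add: n_def)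
    have "x / y = x * cnj y / of_real n"
      using complex_div_cnj[of x y] by (simp add: n_def)
    then have "Re (x / y) = Re (x * cnj y) / n" "Im (x / y) = Im (x * cnj y) / n"
      by (simp_all add: Re_divide_of_real Im_divide_of_real)
    moreover have "(cmod (x / y))\<^sup>2 = (cmod x)\<^sup>2 / n"
      by (simp add: norm_divide power_divide n_def)
    moreover have "1 + (cmod x)\<^sup>2 / n = ((cmod x)\<^sup>2 + n) / n"
      using n by (simp add: field_simps)
    moreover have "(cmod x)\<^sup>2 + n > 0"
      using n by (simp add: add_nonneg_pos)
    ultimately show ?thesis
      using that False n unfolding homogeneous_def unstereo_def n_def[symmetric]
      by (simp add: vec_eq_iff forall_3) (simp add: field_simps)
  qed
  define m where "m = (cmod a)\<^sup>2 + (cmod b)\<^sup>2"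
  define m' where "m' = (cmod a')\<^sup>2 + (cmod b')\<^sup>2"
  have m: "m > 0" "m' > 0" using assms
    by (auto simp: homogeneous_def m_def m'_def intro: add_pos_nonneg add_nonneg_pos)
  have "(2 * Re (a * cnj b)) * (2 * Re (a' * cnj b')) + (2 * Im (a * cnj b)) * (2 * Im (a' * cnj b'))
      + ((cmod a)\<^sup>2 - (cmod b)\<^sup>2) * ((cmod a')\<^sup>2 - (cmod b')\<^sup>2)
      = 2 * (cmod (a * cnj a' + b * cnj b'))\<^sup>2 - m * m'"
    unfolding m_def m'_def cmod_power2 by (simp add: power2_eq_square algebra_simps)
  then have "unstereo u \<bullet> unstereo v
      = (1 / m) * ((1 / m') * (2 * (cmod (a * cnj a' + b * cnj b'))\<^sup>2 - m * m'))"
    unfolding un[OF assms(1)] un[OF assms(2)] m_def[symmetric] m'_def[symmetric]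
      inner_scaleR_left inner_scaleR_right
    unfolding inner_vec_def sum_3 vector_3 inner_real_def by simp
  then show ?thesis
    unfolding m_def[symmetric] m'_def[symmetric] using m by (simp add: field_simps)
qed

text \<open>The coefficient matrix has determinant \<open>1 + c * cnj c\<close>, which is nonzero,
  so the new coordinates do not both vanish.\<close>

lemma homogeneous_tau_Fin:
  assumes "homogeneous u a b"
  shows "homogeneous (tau (Fin c) u) (a + c * b) (b - cnj c * a)"
proof -
  have nz: "1 + c * cnj c \<noteq> 0"
  proof
    assume "1 + c * cnj c = 0"
    then have "complex_of_real (1 + (cmod c)\<^sup>2) = 0"
      by (simp only: complex_norm_square of_real_add of_real_1)
    then show False using pos1[of c] by (simp only: of_real_eq_0_iff)
  qed
  have "a + c * b \<noteq> 0 \<or> b - cnj c * a \<noteq> 0"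
  proof (rule ccontr)
    assume "\<not> ?thesis"
    then have *: "a = - c * b" "b = cnj c * a" by (auto simp: add_eq_0_iff)
    have "b * (1 + c * cnj c) = b - cnj c * (- c * b)" by (simp add: algebra_simps)
    also have "\<dots> = 0" using * by (metis diff_self)
    finally have "b = 0" using nz by simp
    then show False using *(1) \<open>b = 0\<close> assms by (simp add: homogeneous_def)
  qed
  moreover have "tau (Fin c) u = (if b - cnj c * a = 0 then Infty else Fin ((a + c * b) / (b - cnj c * a)))"
  proof (cases "b = 0")
    case True
    then show ?thesis using assms by (auto simp: homogeneous_def)
  next
    case False
    then have "1 - cnj c * (a / b) = (b - cnj c * a) / b" "a / b + c = (a + c * b) / b"
      by (simp_all add: field_simps)
    then show ?thesis using assms False by (simp add: homogeneous_def)
  qed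
  ultimately show ?thesis by (simp add: homogeneous_def)
qed

lemma homogeneous_tau_Infty: "homogeneous u a b \<Longrightarrow> homogeneous (tau Infty u) b a"
  by (auto simp: homogeneous_def)

text \<open>For finite \<open>c\<close> the matrix of \<open>tau c\<close> is unitary up to a
  scalar, whose powers cancel in the homogeneous formula; for \<open>Infty\<close> it swaps the
  coordinates.\<close>

lemma inner_unstereo_tau: "unstereo (tau c u) \<bullet> unstereo (tau c v) = unstereo u \<bullet> unstereo v"
proof -
  obtain a b where u: "homogeneous u a b" by (rule ex_homogeneous)
  obtain a' b' where v: "homogeneous v a' b'" by (rule ex_homogeneous)
  show ?thesis
  proof (cases c)
    case (Fin w)
    define q where "q = 1 + (cmod w)\<^sup>2"
    have q: "q > 0" using pos1 by (simp add: q_def)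
    have n: "(cmod (x + w * y))\<^sup>2 + (cmod (y - cnj w * x))\<^sup>2 = q * ((cmod x)\<^sup>2 + (cmod y)\<^sup>2)" for x y
      unfolding q_def cmod_power2 by (simp add: power2_eq_square algebra_simps)
    have "(a + w * b) * cnj (a' + w * b') + (b - cnj w * a) * cnj (b' - cnj w * a')
        = of_real q * (a * cnj a' + b * cnj b')"
      unfolding q_def of_real_add complex_norm_square by (simp add: algebra_simps)
    then have h: "(cmod ((a + w * b) * cnj (a' + w * b') + (b - cnj w * a) * cnj (b' - cnj w * a')))\<^sup>2
        = q\<^sup>2 * (cmod (a * cnj a' + b * cnj b'))\<^sup>2"
      using q by (simp add: norm_mult power_mult_distrib)
    show ?thesis
      unfolding Fin unstereo_inner_homogeneous[OF u v] h n
        unstereo_inner_homogeneous[OF homogeneous_tau_Fin[OF u] homogeneous_tau_Fin[OF v]]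
      using q by (simp add: power2_eq_square)
  next
    case Infty
    show ?thesis
      unfolding Infty unstereo_inner_homogeneous[OF u v]
        unstereo_inner_homogeneous[OF homogeneous_tau_Infty[OF u] homogeneous_tau_Infty[OF v]]
      by (simp add: add.commute mult.commute)
  qed
qed

text \<open>The squared length of the defect expands into inner products, which \<open>tau c\<close>
  preserves, so the defect remains zero.\<close>

lemma unstereo_tau_linear:
  assumes "unstereo w = A *\<^sub>R unstereo u + B *\<^sub>R unstereo v"
  shows "unstereo (tau c w) = A *\<^sub>R unstereo (tau c u) + B *\<^sub>R unstereo (tau c v)"
proof -
  define gap where "gap x y z = (x - (A *\<^sub>R y + B *\<^sub>R z)) \<bullet> (x - (A *\<^sub>R y + B *\<^sub>R z))" for x y z :: "real^3"
  have "gap (unstereo (tau c w)) (unstereo (tau c u)) (unstereo (tau c v))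
      = gap (unstereo w) (unstereo u) (unstereo v)"
    by (simp add: gap_def inner_simps inner_unstereo_tau)
  also have "\<dots> = 0" using assms by (simp add: gap_def)
  finally show ?thesis by (simp add: gap_def)
qed

lemma tau_Fin_0: "tau c (Fin 0) = c"
  by (cases c) auto

section \<open>Dilations in polar coordinates about their centre\<close>

text \<open>At \<open>x = p\<close> the quotient is \<open>0 / 0 = 0\<close>, which gives the correct value \<open>p\<close>.\<close>

definition radial_dilation :: "'a::real_inner \<Rightarrow> real \<Rightarrow> 'a \<Rightarrow> 'a" where
  "radial_dilation p k x =
     (let \<alpha> = arccos (x \<bullet> p)
      in cos (k * \<alpha>) *\<^sub>R p + (sin (k * \<alpha>) / sin \<alpha>) *\<^sub>R (x - cos \<alpha> *\<^sub>R p))"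

text \<open>Spherical coordinates: for \<open>t \<ge> 0\<close>, \<open>2 * t\<close> is the angle
  from the south pole, the image of \<open>0\<close>.\<close>

lemma unstereo_Fin_rcis_tan:
  assumes "\<bar>t\<bar> < pi / 2"
  shows "unstereo (Fin (rcis (tan t) \<theta>)) =
    vector [sin (2 * t) * cos \<theta>, sin (2 * t) * sin \<theta>, - cos (2 * t)]"
proof -
  have c: "cos t > 0" using assms by (intro cos_gt_zero_pi) auto
  have "1 + (tan t)\<^sup>2 = 1 / (cos t)\<^sup>2"
    using c tan_sec[of t] by (simp add: inverse_eq_divide power_divide)
  moreover have "((tan t)\<^sup>2 - 1) * (cos t)\<^sup>2 = - cos (2 * t)"
    using c by (simp add: tan_def power_divide left_diff_distrib cos_double)
  moreover have "tan t * (2 * (cos t)\<^sup>2) = sin (t * 2)"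
    using c by (simp add: tan_def power2_eq_square sin_double mult.commute[of t])
  ultimately show ?thesis
    by (simp add: unstereo_def mult_ac)
qed

text \<open>The polar angle is multiplied by \<open>k\<close> and the argument is kept. The sign
  condition excludes \<open>Infty\<close>, where \<open>sdilation0\<close> is unspecified.\<close>

lemma unstereo_sdilation0:
  assumes "0 < k" "k \<le> 1" "0 \<le> unstereo z \<bullet> unstereo (Fin 0)"
  shows "unstereo (sdilation0 k z) = radial_dilation (unstereo (Fin 0)) k (unstereo z)"
proof -
  have s0: "unstereo (Fin 0) = vector [0, 0, -1]" by (simp add: unstereo_def)
  obtain \<zeta> where z: "z = Fin \<zeta>"
    using assms(3) by (cases z) (auto simp: unstereo_def inner_vec_def sum_3)
  define \<alpha> where "\<alpha> = sdist (Fin 0) z"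
  have \<alpha>: "\<alpha> = 2 * arctan (cmod \<zeta>)" by (simp add: \<alpha>_def z)
  have ca: "unstereo z \<bullet> unstereo (Fin 0) = cos \<alpha>"
    by (simp only: \<alpha>_def cos_sdist inner_commute)
  have r: "0 \<le> \<alpha>" "\<alpha> < pi" using arctan_ubound[of "cmod \<zeta>"] by (auto simp: \<alpha>)
  then have arc: "arccos (unstereo z \<bullet> unstereo (Fin 0)) = \<alpha>" by (simp add: ca arccos_cos)
  have "k * \<alpha> \<le> \<alpha>" using assms r by (simp add: mult_left_le_one_le)
  with r assms have r': "0 \<le> k * \<alpha>" "k * \<alpha> < pi" by auto
  have "\<zeta> = rcis (tan (\<alpha> / 2)) (Arg \<zeta>)" by (simp add: \<alpha> tan_arctan rcis_cmod_Arg)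
  then have uz: "unstereo z = vector [sin \<alpha> * cos (Arg \<zeta>), sin \<alpha> * sin (Arg \<zeta>), - cos \<alpha>]"
    using unstereo_Fin_rcis_tan[of "\<alpha> / 2" "Arg \<zeta>"] r z by simp
  have "sdilation0 k z = Fin (rcis (tan (k * \<alpha> / 2)) (Arg \<zeta>))"
    using r' by (simp add: z \<alpha>)
  then have "unstereo (sdilation0 k z)
      = vector [sin (k * \<alpha>) * cos (Arg \<zeta>), sin (k * \<alpha>) * sin (Arg \<zeta>), - cos (k * \<alpha>)]"
    using unstereo_Fin_rcis_tan[of "k * \<alpha> / 2" "Arg \<zeta>"] r' by simp
  \<comment> \<open>At \<open>\<alpha> = 0\<close> both sides are \<open>0\<close>, whatever the
    quotient.\<close>
  moreover have "sin (k * \<alpha>) / sin \<alpha> * sin \<alpha> = sin (k * \<alpha>)"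
    using r sin_gt_zero[of \<alpha>] by (cases "\<alpha> = 0") auto
  then have "sin (k * \<alpha>) / sin \<alpha> * (sin \<alpha> * x) = sin (k * \<alpha>) * x" for x
    by (metis mult.assoc)
  ultimately show ?thesis
    unfolding radial_dilation_def Let_def arc
    unfolding uz s0 by (simp add: vec_eq_iff forall_3)
qed

text \<open>\<open>radial_dilation p k x\<close> combines \<open>p\<close> and \<open>x\<close> with
  coefficients depending only on \<open>x \<bullet> p\<close>, so it commutes with
  \<open>tau c\<close>, and the case of centre \<open>0\<close> transfers.\<close>

lemma unstereo_sdilation:
  assumes "0 < k" "k \<le> 1" "z \<in> closed_hemisphere c"
  shows "unstereo (sdilation c k z) = radial_dilation (unstereo c) k (unstereo z)"
proof -
  define y where "y = inv (tau c) z"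
  have y: "tau c y = z" unfolding y_def using bij_tau by (simp add: bij_is_surj surj_f_inv_f)
  have i: "unstereo z \<bullet> unstereo c = unstereo y \<bullet> unstereo (Fin 0)"
    using inner_unstereo_tau[of c y "Fin 0"] by (simp only: y tau_Fin_0)
  have "0 \<le> cos (sdist c z)" using assms(3) sdist_range[of c z]
    by (intro cos_ge_zero) (auto simp: closed_hemisphere_def)
  then have ge: "0 \<le> unstereo y \<bullet> unstereo (Fin 0)"
    by (simp only: cos_sdist inner_commute[of "unstereo c"] i)
  have lin: "radial_dilation p k x =
      (cos (k * arccos (x \<bullet> p)) - sin (k * arccos (x \<bullet> p)) / sin (arccos (x \<bullet> p)) * cos (arccos (x \<bullet> p))) *\<^sub>R p
      + (sin (k * arccos (x \<bullet> p)) / sin (arccos (x \<bullet> p))) *\<^sub>R x" for x p :: "real^3"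
    by (simp add: radial_dilation_def Let_def algebra_simps)
  have "unstereo (tau c (sdilation0 k y)) = radial_dilation (unstereo (tau c (Fin 0))) k (unstereo (tau c y))"
    unfolding lin inner_unstereo_tau
    by (rule unstereo_tau_linear) (simp only: unstereo_sdilation0[OF assms(1,2) ge] lin)
  then show ?thesis by (simp add: sdilation_def y_def[symmetric] y tau_Fin_0)
qed

section \<open>Convex sets on the unit sphere\<close>

text \<open>This is \<open>s_convex\<close> carried to the sphere; at \<open>L = pi\<close> the
  direction \<open>f\<close> is free, so all semicircles between antipodal points are
  included.\<close>

definition arc_closed :: "(real^3) set \<Rightarrow> bool" where
  "arc_closed S \<longleftrightarrow> (\<forall>e f L t. orthonormal_pair e f \<longrightarrow> 0 \<le> t \<longrightarrow> t \<le> L \<longrightarrow> L \<le> pi \<longrightarrow>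
     e \<in> S \<longrightarrow> gc_point e f L \<in> S \<longrightarrow> gc_point e f t \<in> S)"

lemma gc_point_0: "gc_point e f 0 = e"
  by (simp add: gc_point_def)

lemma s_convex_iff_arc_closed: "s_convex C \<longleftrightarrow> arc_closed (unstereo ` C)"
proof
  assume C: "s_convex C"
  show "arc_closed (unstereo ` C)"
    unfolding arc_closed_def
  proof (intro allI impI)
    fix e f :: "real^3" and L t :: real
    assume ef: "orthonormal_pair e f" and t: "0 \<le> t" "t \<le> L" "L \<le> pi"
      and "e \<in> unstereo ` C" "gc_point e f L \<in> unstereo ` C"
    then have "stereo e \<in> C" "stereo (gc_point e f L) \<in> C" by (auto simp: stereo_unstereo)
    moreover have "geodesic_segment (stereo e) (stereo (gc_point e f L)) (great_arc e f L)"
      unfolding geodesic_segment_def using ef t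
      by (intro exI[of _ e] exI[of _ f] exI[of _ L]) (simp add: gc_point_0)
    ultimately have "great_arc e f L \<subseteq> C" using C by (auto simp: s_convex_def)
    then have "stereo (gc_point e f t) \<in> C" using t by (auto simp: great_arc_def)
    then show "gc_point e f t \<in> unstereo ` C"
      using unstereo_stereo[OF norm_gc_point[OF ef]] by (metis imageI)
  qed
next
  assume S: "arc_closed (unstereo ` C)"
  show "s_convex C"
    unfolding s_convex_def
  proof (intro ballI allI impI subsetI)
    fix u v A z
    assume uv: "u \<in> C" "v \<in> C" and "geodesic_segment u v A" and z: "z \<in> A"
    then obtain e f L where *: "orthonormal_pair e f" "0 \<le> L" "L \<le> pi"
      "stereo (gc_point e f 0) = u" "stereo (gc_point e f L) = v" "A = great_arc e f L"
      unfolding geodesic_segment_def by auto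
    have "gc_point e f 0 = unstereo u" "gc_point e f L = unstereo v"
      using * norm_gc_point unstereo_stereo by auto
    then have "e \<in> unstereo ` C" "gc_point e f L \<in> unstereo ` C" using uv by (auto simp: gc_point_0)
    moreover obtain t where t: "0 \<le> t" "t \<le> L" "z = stereo (gc_point e f t)"
      using z * by (auto simp: great_arc_def)
    ultimately have "gc_point e f t \<in> unstereo ` C" using S * unfolding arc_closed_def by blast
    then show "z \<in> C" using t by (auto simp: stereo_unstereo)
  qed
qed

text \<open>The combination is a point of the arc from \<open>x\<close> to \<open>y\<close>:
  \<open>b \<ge> 0\<close> puts its angle \<open>t\<close> in \<open>[0, pi]\<close>, and
  \<open>a \<ge> 0\<close> gives \<open>t \<le> L\<close>.\<close>

lemma arc_closed_combination:
  assumes S: "arc_closed S" and xy: "x \<in> S" "y \<in> S" "norm x = 1" "norm y = 1" "x \<noteq> - y"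
    and ab: "0 \<le> a" "0 \<le> b" and w: "norm (a *\<^sub>R x + b *\<^sub>R y) = 1"
  shows "a *\<^sub>R x + b *\<^sub>R y \<in> S"
proof (cases "x = y")
  case True
  then have e: "a *\<^sub>R x + b *\<^sub>R y = (a + b) *\<^sub>R x" by (simp add: scaleR_add_left)
  then have "a + b = 1" using w ab xy by simp
  then show ?thesis using e xy by simp
next
  case False
  have i: "x \<bullet> x = 1" "y \<bullet> y = 1" using xy by (simp_all add: norm_eq_1)
  define L where "L = arccos (x \<bullet> y)"
  have "x \<bullet> y \<noteq> 1"
  proof
    assume "x \<bullet> y = 1"
    then have "(x - y) \<bullet> (x - y) = 0" using i by (simp add: inner_simps inner_commute)
    then show False using False by simp
  qed
  moreover have "x \<bullet> y \<noteq> -1"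
  proof
    assume "x \<bullet> y = -1"
    then have "(x + y) \<bullet> (x + y) = 0" using i by (simp add: inner_simps inner_commute)
    then show False using xy(5) by (simp add: add_eq_0_iff)
  qed
  moreover have "\<bar>x \<bullet> y\<bar> \<le> 1" using Cauchy_Schwarz_ineq2[of x y] xy by simp
  ultimately have xy1: "-1 < x \<bullet> y" "x \<bullet> y < 1" by auto
  then have L: "0 < L" "L < pi" "cos L = x \<bullet> y"
    using arccos_lt_bounded[of "x \<bullet> y"] by (auto simp: L_def)
  then have s: "sin L > 0" by (simp add: sin_gt_zero)
  \<comment> \<open>Gram-Schmidt, chosen so that \<open>gc_point x f L = y\<close>.\<close>
  define f where "f = (y - cos L *\<^sub>R x) /\<^sub>R sin L"
  have sf: "sin L *\<^sub>R f = y - cos L *\<^sub>R x" using s by (simp add: f_def)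
  have "(y - cos L *\<^sub>R x) \<bullet> (y - cos L *\<^sub>R x) = 1 - (cos L)\<^sup>2"
    using i L(3) by (simp add: inner_simps inner_commute power2_eq_square)
  then have "(sin L *\<^sub>R f) \<bullet> (sin L *\<^sub>R f) = (sin L)\<^sup>2" by (simp only: sf sin_squared_eq)
  then have ff: "f \<bullet> f = 1" using s by (simp add: power2_eq_square)
  have xf: "x \<bullet> f = 0" using i L(3) by (simp add: f_def inner_simps)
  have on: "orthonormal_pair x f" using ff xf xy by (simp add: orthonormal_pair_def norm_eq_1)
  have y: "y = cos L *\<^sub>R x + sin L *\<^sub>R f" by (simp add: sf)
  define A where "A = a + b * cos L"
  define B where "B = b * sin L"
  have we: "a *\<^sub>R x + b *\<^sub>R y = A *\<^sub>R x + B *\<^sub>R f"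
    unfolding A_def B_def by (subst y) (simp add: algebra_simps)
  have "A\<^sup>2 + B\<^sup>2 = (A *\<^sub>R x + B *\<^sub>R f) \<bullet> (A *\<^sub>R x + B *\<^sub>R f)"
    using i ff xf by (simp add: inner_simps inner_commute power2_eq_square)
  then have "A\<^sup>2 + B\<^sup>2 = 1" using w unfolding we norm_eq_1 by simp
  moreover have "0 \<le> B" using ab s by (simp add: B_def)
  ultimately obtain t where t: "0 \<le> t" "t \<le> pi" "A = cos t" "B = sin t"
    using sincos_total_pi by metis
  have "sin (L - t) = a * sin L"
    unfolding sin_diff t(3,4)[symmetric] A_def B_def by (simp add: algebra_simps)
  then have "0 \<le> sin (L - t)" using ab s by simp
  moreover have "sin (t - L) > 0" if "t > L" using that t L by (intro sin_gt_zero) auto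
  ultimately have "t \<le> L" using sin_minus[of "t - L"] by fastforce
  then have "gc_point x f t \<in> S"
    using S on t(1) L xy y unfolding arc_closed_def gc_point_def by (metis less_imp_le)
  then show ?thesis by (simp add: we t gc_point_def)
qed

text \<open>A set containing an antipodal pair contains all semicircles joining it, in particular
  a full great circle through \<open>p\<close>, hence also \<open>- p\<close>.\<close>

lemma arc_closed_no_antipodal:
  assumes S: "arc_closed S" and p: "p \<in> S" "norm p = 1" and hemi: "\<And>x. x \<in> S \<Longrightarrow> 0 \<le> x \<bullet> p"
    and x: "x \<in> S" "norm x = 1"
  shows "- x \<notin> S"
proof
  assume mx: "- x \<in> S"
  have "x \<bullet> p = 0" using hemi[OF x(1)] hemi[OF mx] by simp
  then have "orthonormal_pair x (- p)" using x p by (simp add: orthonormal_pair_def)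
  then have "gc_point x (- p) (pi / 2) \<in> S"
    using S x(1) mx unfolding arc_closed_def
    by (elim allE[of _ x] allE[of _ "- p"] allE[of _ pi] allE[of _ "pi / 2"]) (simp add: gc_point_def)
  then have "0 \<le> - p \<bullet> p" using hemi[of "- p"] by (simp add: gc_point_def)
  then show False using p by (simp add: norm_eq_1)
qed

text \<open>Normalise the part in \<open>x\<close> and \<open>y\<close> to a point \<open>z\<close>
  of \<open>S\<close>, then combine \<open>z\<close> with \<open>p\<close>. The hemisphere condition
  rules out antipodal pairs in both steps.\<close>

lemma arc_closed_combination3:
  assumes S: "arc_closed S" "S \<subseteq> sphere 0 1" and p: "p \<in> S" and hemi: "\<And>x. x \<in> S \<Longrightarrow> 0 \<le> x \<bullet> p"
    and xy: "x \<in> S" "y \<in> S" and c: "0 \<le> a" "0 \<le> b" "0 \<le> c"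
    and w: "norm (a *\<^sub>R x + b *\<^sub>R y + c *\<^sub>R p) = 1"
  shows "a *\<^sub>R x + b *\<^sub>R y + c *\<^sub>R p \<in> S"
proof -
  have n: "norm z = 1" if "z \<in> S" for z using that S by auto
  have ne: "z \<noteq> - z'" if "z \<in> S" "z' \<in> S" for z z'
    using arc_closed_no_antipodal[OF S(1) p n[OF p] hemi that(2) n[OF that(2)]] that by auto
  define m where "m = norm (a *\<^sub>R x + b *\<^sub>R y)"
  show ?thesis
  proof (cases "m = 0")
    case True
    then have e: "a *\<^sub>R x + b *\<^sub>R y = 0" by (simp add: m_def)
    then have "c = 1" using w c n[OF p] by simp
    then show ?thesis using e p by simp
  next
    case False
    then have m: "m > 0" by (simp add: m_def)
    define z where "z = (a / m) *\<^sub>R x + (b / m) *\<^sub>R y"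
    have mz: "m *\<^sub>R z = a *\<^sub>R x + b *\<^sub>R y" using m by (simp add: z_def scaleR_add_right)
    then have "m * norm z = m" using m by (metis m_def norm_scaleR abs_of_pos)
    then have "norm z = 1" using m by simp
    then have "z \<in> S" unfolding z_def
      using m c
      by (intro arc_closed_combination[OF S(1) xy n[OF xy(1)] n[OF xy(2)] ne[OF xy]])
        (auto simp: z_def[symmetric])
    then have "m *\<^sub>R z + c *\<^sub>R p \<in> S"
      using w m c
      by (intro arc_closed_combination[OF S(1) \<open>z \<in> S\<close> p n[OF \<open>z \<in> S\<close>] n[OF p] ne[OF \<open>z \<in> S\<close> p]])
        (simp_all add: mz)
    then show ?thesis by (simp add: mz)
  qed
qed

text \<open>Spherical linear interpolation, with weights \<open>sin (L - t) / sin L\<close> and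
  \<open>sin t / sin L\<close>.\<close>

lemma gc_point_combination:
  assumes "0 \<le> t" "t \<le> L" "0 < L" "L < pi"
  obtains a b where "0 \<le> a" "0 \<le> b" "gc_point e f t = a *\<^sub>R e + b *\<^sub>R gc_point e f L"
proof
  have s: "sin L > 0" using assms by (intro sin_gt_zero) auto
  show "0 \<le> sin (L - t) / sin L" "0 \<le> sin t / sin L"
    using assms s by (auto intro!: divide_nonneg_pos sin_ge_zero)
  have "sin (L - t) / sin L + sin t / sin L * cos L = cos t"
    using s by (simp add: sin_diff field_simps)
  moreover have "sin t / sin L * sin L = sin t" using s by simp
  ultimately show "gc_point e f t = (sin (L - t) / sin L) *\<^sub>R e + (sin t / sin L) *\<^sub>R gc_point e f L"
    unfolding gc_point_def scaleR_add_right scaleR_scaleR by (metis add.assoc scaleR_add_left)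
qed

section \<open>Dilations preserve convexity\<close>

lemma radial_dilation_polar:
  assumes "0 \<le> \<alpha>" "\<alpha> \<le> pi" "norm p = 1" "X \<bullet> p = 0"
  shows "radial_dilation p k (cos \<alpha> *\<^sub>R p + X) = cos (k * \<alpha>) *\<^sub>R p + (sin (k * \<alpha>) / sin \<alpha>) *\<^sub>R X"
proof -
  have "(cos \<alpha> *\<^sub>R p + X) \<bullet> p = cos \<alpha>" using assms by (simp add: inner_simps norm_eq_1)
  then have "arccos ((cos \<alpha> *\<^sub>R p + X) \<bullet> p) = \<alpha>" using assms by (simp add: arccos_cos)
  then show ?thesis by (simp add: radial_dilation_def)
qed

lemma polar_coordinates:
  fixes p x :: "'a::real_inner"
  assumes "norm p = 1" "norm x = 1" "0 \<le> x \<bullet> p"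
  obtains \<alpha> X where "0 \<le> \<alpha>" "\<alpha> \<le> pi / 2" "x = cos \<alpha> *\<^sub>R p + X" "X \<bullet> p = 0" "norm X = sin \<alpha>"
proof
  define \<alpha> where "\<alpha> = arccos (x \<bullet> p)"
  have le: "x \<bullet> p \<le> 1" using norm_cauchy_schwarz[of x p] assms by simp
  then show \<alpha>: "0 \<le> \<alpha>" "\<alpha> \<le> pi / 2"
    using assms arccos_bounded[of "x \<bullet> p"] arccos_le_pi2[of "x \<bullet> p"] by (auto simp: \<alpha>_def)
  have c: "cos \<alpha> = x \<bullet> p" using le assms by (simp add: \<alpha>_def cos_arccos)
  have i: "x \<bullet> x = 1" "p \<bullet> p = 1" using assms by (simp_all add: norm_eq_1)
  define X where "X = x - cos \<alpha> *\<^sub>R p"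
  show "x = cos \<alpha> *\<^sub>R p + X" by (simp add: X_def)
  show "X \<bullet> p = 0" using i by (simp add: X_def inner_simps c)
  have "(norm X)\<^sup>2 = 1 - (cos \<alpha>)\<^sup>2"
    unfolding power2_norm_eq_inner X_def using i
    by (simp add: inner_simps inner_commute c power2_eq_square)
  also have "\<dots> = (sin \<alpha>)\<^sup>2" by (simp add: sin_squared_eq)
  finally show "norm X = sin \<alpha>"
    using \<alpha> by (intro power2_eq_imp_eq[of "norm X" "sin \<alpha>"]) (auto intro!: sin_ge_zero)
qed

text \<open>The core step: every point on an arc between dilated points is the dilation of a
  nonnegative combination of \<open>x\<close>, \<open>y\<close> and \<open>p\<close>.\<close>

lemma radial_dilation_combination:
  fixes p x y :: "'a::real_inner"
  assumes k: "0 < k" "k < 1" and p: "norm p = 1"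
    and x: "norm x = 1" "0 \<le> x \<bullet> p" and y: "norm y = 1" "0 \<le> y \<bullet> p"
    and st: "0 \<le> s" "0 \<le> t"
    and w: "w = s *\<^sub>R radial_dilation p k x + t *\<^sub>R radial_dilation p k y" "norm w = 1"
  obtains a b c where "0 \<le> a" "0 \<le> b" "0 \<le> c" "norm (a *\<^sub>R x + b *\<^sub>R y + c *\<^sub>R p) = 1"
    "radial_dilation p k (a *\<^sub>R x + b *\<^sub>R y + c *\<^sub>R p) = w"
proof -
  have pp: "p \<bullet> p = 1" using p by (simp add: norm_eq_1)
  obtain \<alpha> X where X: "0 \<le> \<alpha>" "\<alpha> \<le> pi / 2" "x = cos \<alpha> *\<^sub>R p + X" "X \<bullet> p = 0" "norm X = sin \<alpha>"
    using polar_coordinates p x by blast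
  obtain \<beta> Y where Y: "0 \<le> \<beta>" "\<beta> \<le> pi / 2" "y = cos \<beta> *\<^sub>R p + Y" "Y \<bullet> p = 0" "norm Y = sin \<beta>"
    using polar_coordinates p y by blast
  define ra where "ra = sin (k * \<alpha>) / sin \<alpha>"
  define rb where "rb = sin (k * \<beta>) / sin \<beta>"
  \<comment> \<open>\<open>h\<close> and \<open>Q\<close> are the components of \<open>w\<close>
    along and orthogonal to \<open>p\<close>; later \<open>h = cos g\<close> and
    \<open>norm Q = sin g\<close>.\<close>
  define h where "h = s * cos (k * \<alpha>) + t * cos (k * \<beta>)"
  define Q where "Q = (s * ra) *\<^sub>R X + (t * rb) *\<^sub>R Y"
  define q where "q = norm Q"
  have "radial_dilation p k x = cos (k * \<alpha>) *\<^sub>R p + ra *\<^sub>R X"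
    "radial_dilation p k y = cos (k * \<beta>) *\<^sub>R p + rb *\<^sub>R Y"
    unfolding X(3) Y(3) ra_def rb_def using X Y p by (intro radial_dilation_polar; simp)+
  then have wQ: "w = h *\<^sub>R p + Q" by (simp add: w h_def Q_def algebra_simps)
  have Qp: "Q \<bullet> p = 0" using X Y by (simp add: Q_def inner_simps)
  then have pQ: "p \<bullet> Q = 0" by (simp only: inner_commute)
  have "w \<bullet> w = h\<^sup>2 + q\<^sup>2"
    unfolding wQ q_def power2_norm_eq_inner
    using Qp pQ pp by (simp add: inner_simps power2_eq_square)
  then have hq: "h\<^sup>2 + q\<^sup>2 = 1" using w(2) by (simp add: norm_eq_1)
  have angle: "0 \<le> k * \<theta>" "k * \<theta> < pi / 2" "k * \<theta> \<le> k * pi / 2" "0 < cos (k * \<theta>)"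
      "sin (k * \<theta>) / sin \<theta> * sin \<theta> = sin (k * \<theta>)" "0 \<le> sin (k * \<theta>) / sin \<theta>"
      "0 \<le> tan (k * \<theta>)" "tan (k * \<theta>) \<le> tan (k * pi / 2)"
      "dilation_profile k (tan (k * \<theta>)) = tan (k * \<theta>) * cot \<theta>"
    if "0 \<le> \<theta>" "\<theta> \<le> pi / 2" for \<theta>
  proof -
    show kt: "0 \<le> k * \<theta>" "k * \<theta> \<le> k * pi / 2" using k that by simp_all
    have "k * pi < pi" using k by simp
    with kt show kt': "k * \<theta> < pi / 2" by linarith
    show "0 < cos (k * \<theta>)" using kt kt' by (intro cos_gt_zero_pi) auto
    have "sin \<theta> > 0" if "\<theta> \<noteq> 0" using \<open>0 \<le> \<theta>\<close> \<open>\<theta> \<le> pi / 2\<close> that pi_gt_zero by (intro sin_gt_zero) linarith+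
    then show "sin (k * \<theta>) / sin \<theta> * sin \<theta> = sin (k * \<theta>)" by (cases "\<theta> = 0") auto
    show "0 \<le> sin (k * \<theta>) / sin \<theta>"
      using kt kt' that pi_gt_zero by (intro divide_nonneg_nonneg sin_ge_zero) linarith+
    show "0 \<le> tan (k * \<theta>)"
      using \<open>0 < cos (k * \<theta>)\<close> kt kt' unfolding tan_def
      by (intro divide_nonneg_nonneg sin_ge_zero) linarith+
    show "tan (k * \<theta>) \<le> tan (k * pi / 2)"
      using kt \<open>k * pi < pi\<close> pi_gt_zero by (intro tan_mono_le) linarith+
    show "dilation_profile k (tan (k * \<theta>)) = tan (k * \<theta>) * cot \<theta>"
      using dilation_profile_tan[where x = "k * \<theta>" and k = k] kt kt' k by simp
  qed
  note A = angle[OF X(1,2)] and B = angle[OF Y(1,2)]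
  have ra: "0 \<le> ra" "ra * sin \<alpha> = sin (k * \<alpha>)" using A by (simp_all add: ra_def)
  have rb: "0 \<le> rb" "rb * sin \<beta> = sin (k * \<beta>)" using B by (simp_all add: rb_def)
  have h: "h > 0"
  proof (rule ccontr)
    assume "\<not> h > 0"
    moreover have "0 \<le> s * cos (k * \<alpha>)" "0 \<le> t * cos (k * \<beta>)" using A B st by simp_all
    ultimately have "s * cos (k * \<alpha>) = 0" "t * cos (k * \<beta>) = 0" unfolding h_def by linarith+
    then have "s = 0" "t = 0" using A B by auto
    then show False using hq by (simp add: h_def q_def Q_def)
  qed
  show thesis
  proof (cases "q = 0")
    case True
    then have "h = 1" using hq h by (simp add: power2_eq_1_iff)
    moreover have "radial_dilation p k p = p"
      using radial_dilation_polar[of 0 p 0 k] p by simp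
    ultimately show thesis using that[of 0 0 1] True p by (simp add: wQ q_def)
  next
    case False
    then have q: "q > 0" by (simp add: q_def)
    then obtain g where g: "0 \<le> g" "g \<le> pi / 2" "h = cos g" "q = sin g"
      using sincos_total_pi_half[of h q] h hq by auto
    have g2: "0 < g" "g < pi / 2"
      using g h q by (metis sin_zero less_irrefl order_le_less, metis cos_pi_half less_irrefl order_le_less)
    \<comment> \<open>The angle from \<open>p\<close> to the preimage of \<open>w\<close>.\<close>
    define \<gamma> where "\<gamma> = g / k"
    have kg: "k * \<gamma> = g" using k by (simp add: \<gamma>_def)
    have tang: "tan g = q / h" by (simp add: tan_def g)
    \<comment> \<open>The gnomonic image of \<open>w\<close> is the convex combination, with weights
      \<open>a\<close> and \<open>b\<close>, of those of the dilated points.\<close>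
    define a where "a = s * cos (k * \<alpha>) / h"
    define b where "b = t * cos (k * \<beta>) / h"
    have ab: "0 \<le> a" "0 \<le> b" "a + b = 1" using A B st h
      by (simp_all add: a_def b_def add_divide_distrib[symmetric] h_def[symmetric])
    have aT: "a * tan (k * \<alpha>) = s * sin (k * \<alpha>) / h" using A by (simp add: a_def tan_def)
    have bT: "b * tan (k * \<beta>) = t * sin (k * \<beta>) / h" using B by (simp add: b_def tan_def)
    \<comment> \<open>Only an inequality, since \<open>X\<close> and \<open>Y\<close> may point in
      different directions; monotonicity of the profile absorbs the loss.\<close>
    have "q \<le> norm ((s * ra) *\<^sub>R X) + norm ((t * rb) *\<^sub>R Y)"
      unfolding q_def Q_def by (rule norm_triangle_ineq)
    also have "\<dots> = s * sin (k * \<alpha>) + t * sin (k * \<beta>)"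
      using st ra rb X Y by (simp add: mult.assoc)
    finally have "tan g \<le> a * tan (k * \<alpha>) + b * tan (k * \<beta>)"
      unfolding tang aT bT add_divide_distrib[symmetric] using h by (simp add: divide_right_mono)
    note tan_le = this
    have tg: "0 < tan g" using h q by (simp add: tang)
    then have
      "a * dilation_profile k (tan (k * \<alpha>)) + b * dilation_profile k (tan (k * \<beta>))
        \<le> dilation_profile k (tan g)"
      using ab A(7,8) B(7,8) tan_le by (intro dilation_profile_combination k)
    moreover have "dilation_profile k (tan g) = tan g * cot \<gamma>"
      using dilation_profile_tan[where x = g and k = k] g2 k by (simp add: \<gamma>_def)
    ultimately have "(a * tan (k * \<alpha>)) * cot \<alpha> + (b * tan (k * \<beta>)) * cot \<beta> \<le> tan g * cot \<gamma>"
      by (simp only: A(9) B(9) mult.assoc)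
    then have "(s * sin (k * \<alpha>) * cot \<alpha> + t * sin (k * \<beta>) * cot \<beta>) / h \<le> q * cot \<gamma> / h"
      unfolding aT bT tang by (simp add: add_divide_distrib)
    then have key: "s * sin (k * \<alpha>) * cot \<alpha> + t * sin (k * \<beta>) * cot \<beta> \<le> q * cot \<gamma>"
      using h by (simp add: divide_le_cancel)
    have "tan g \<le> tan (k * pi / 2)"
      using tan_le A(8) B(8) ab convex_bound_le[of "tan (k * \<alpha>)" "tan (k * pi / 2)" "tan (k * \<beta>)" a b]
      by linarith
    then have \<gamma>: "0 < \<gamma>" "\<gamma> \<le> pi / 2"
      using arctan_scaled_bounds[OF k tg] g2 by (simp_all add: arctan_tan \<gamma>_def)
    then have sg: "sin \<gamma> > 0" using pi_gt_zero by (intro sin_gt_zero) linarith+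
    \<comment> \<open>Scales \<open>Q\<close> to the orthogonal part of the preimage. This fixes the
      coefficients of \<open>x\<close> and \<open>y\<close>, and \<open>c\<close> is what remains
      along \<open>p\<close>.\<close>
    define m where "m = sin \<gamma> / q"
    have m: "m > 0" using sg q by (simp add: m_def)
    define c where "c = cos \<gamma> - m * s * ra * cos \<alpha> - m * t * rb * cos \<beta>"
    \<comment> \<open>So \<open>c \<ge> 0\<close> is exactly the profile inequality
      \<open>key\<close>.\<close>
    have "c = m * (q * cot \<gamma> - (s * sin (k * \<alpha>) * cot \<alpha> + t * sin (k * \<beta>) * cot \<beta>))"
      using sg q by (simp add: c_def m_def ra_def rb_def cot_def field_simps)
    then have c: "0 \<le> c" using key m by simp
    have e: "(m * s * ra) *\<^sub>R x + (m * t * rb) *\<^sub>R y + c *\<^sub>R p = cos \<gamma> *\<^sub>R p + m *\<^sub>R Q"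
      by (simp add: X(3) Y(3) Q_def c_def algebra_simps)
    have "(norm (cos \<gamma> *\<^sub>R p + m *\<^sub>R Q))\<^sup>2 = (cos \<gamma>)\<^sup>2 + m\<^sup>2 * (Q \<bullet> Q)"
      unfolding power2_norm_eq_inner
      using Qp pQ pp by (simp add: inner_simps power2_eq_square)
    also have "m\<^sup>2 * (Q \<bullet> Q) = (m * q)\<^sup>2" by (simp add: q_def power_mult_distrib power2_norm_eq_inner)
    also have "m * q = sin \<gamma>" using q by (simp add: m_def)
    finally have n: "norm (cos \<gamma> *\<^sub>R p + m *\<^sub>R Q) = 1"
      by (simp add: norm_eq_1 power2_norm_eq_inner)
    have "radial_dilation p k (cos \<gamma> *\<^sub>R p + m *\<^sub>R Q) = h *\<^sub>R p + (q / sin \<gamma> * m) *\<^sub>R Q"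
      using \<gamma> Qp p pi_gt_zero by (subst radial_dilation_polar) (simp_all add: kg g)
    also have "q / sin \<gamma> * m = 1" using q sg by (simp add: m_def)
    finally have "radial_dilation p k (cos \<gamma> *\<^sub>R p + m *\<^sub>R Q) = w" by (simp add: wQ)
    moreover have "0 \<le> m * s * ra" "0 \<le> m * t * rb" using m st ra rb by simp_all
    ultimately show thesis using that[of "m * s * ra" "m * t * rb" c] c n unfolding e by blast
  qed
qed

text \<open>For \<open>k < 1\<close> the dilated set lies in the open hemisphere about
  \<open>p\<close>, so no antipodal endpoints occur, and interpolation weights reduce each arc to
  \<open>radial_dilation_combination\<close>.\<close>

lemma arc_closed_radial_dilation:
  assumes S: "arc_closed S" "S \<subseteq> sphere 0 1" and p: "p \<in> S" and hemi: "\<And>x. x \<in> S \<Longrightarrow> 0 \<le> x \<bullet> p"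
    and k: "0 < k" "k < 1"
  shows "arc_closed (radial_dilation p k ` S)"
  unfolding arc_closed_def
proof (intro allI impI)
  fix e f :: "real^3" and L t :: real
  assume ef: "orthonormal_pair e f" and t: "0 \<le> t" "t \<le> L" "L \<le> pi"
    and e: "e \<in> radial_dilation p k ` S" and v: "gc_point e f L \<in> radial_dilation p k ` S"
  have n: "norm z = 1" if "z \<in> S" for z using that S by auto
  have pos: "0 < radial_dilation p k z \<bullet> p" if z: "z \<in> S" for z
  proof -
    obtain \<alpha> X where X: "0 \<le> \<alpha>" "\<alpha> \<le> pi / 2" "z = cos \<alpha> *\<^sub>R p + X" "X \<bullet> p = 0"
      using polar_coordinates n[OF p] n[OF z] hemi[OF z] by blast
    have "k * \<alpha> \<le> k * (pi / 2)" "k * (pi / 2) < pi / 2" using k X by simp_all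
    then have "k * \<alpha> < pi / 2" by linarith
    moreover have "0 \<le> k * \<alpha>" using k X by simp
    ultimately have "0 < cos (k * \<alpha>)" by (intro cos_gt_zero_pi) linarith+
    moreover have "radial_dilation p k z \<bullet> p = cos (k * \<alpha>)"
      unfolding X(3) using X n[OF p] by (subst radial_dilation_polar) (simp_all add: inner_simps norm_eq_1)
    ultimately show ?thesis by simp
  qed
  obtain x y where x: "x \<in> S" "e = radial_dilation p k x" and y: "y \<in> S" "gc_point e f L = radial_dilation p k y"
    using e v by auto
  show "gc_point e f t \<in> radial_dilation p k ` S"
  proof (cases "L = 0")
    case True
    then show ?thesis using t e by (simp add: gc_point_0)
  next
    case False
    have "L \<noteq> pi"
    proof
      assume "L = pi"
      then have "radial_dilation p k y = - radial_dilation p k x"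
        using x(2) y(2) by (simp add: gc_point_def)
      then show False using pos[OF x(1)] pos[OF y(1)] by simp
    qed
    then obtain a b where ab: "0 \<le> a" "0 \<le> b" "gc_point e f t = a *\<^sub>R e + b *\<^sub>R gc_point e f L"
      using gc_point_combination[of t L e f] t False by (metis order_le_less order.trans)
    obtain a' b' c' where *: "0 \<le> a'" "0 \<le> b'" "0 \<le> c'" "norm (a' *\<^sub>R x + b' *\<^sub>R y + c' *\<^sub>R p) = 1"
      "radial_dilation p k (a' *\<^sub>R x + b' *\<^sub>R y + c' *\<^sub>R p) = gc_point e f t"
      using radial_dilation_combination[OF k n[OF p] n[OF x(1)] hemi[OF x(1)] n[OF y(1)] hemi[OF y(1)] ab(1,2),
        of "gc_point e f t"] ab(3) norm_gc_point[OF ef] x(2) y(2) by metis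
    then have "a' *\<^sub>R x + b' *\<^sub>R y + c' *\<^sub>R p \<in> S"
      by (intro arc_closed_combination3[OF S p hemi x(1) y(1)])
    then show ?thesis using * by (metis imageI)
  qed
qed

text \<open>If \<open>sin \<alpha> = 0\<close> the quotient is \<open>0\<close> instead of
  \<open>1\<close>, but then \<open>X = 0\<close>.\<close>

lemma radial_dilation_1:
  assumes "norm p = 1" "norm x = 1" "0 \<le> x \<bullet> p"
  shows "radial_dilation p 1 x = x"
proof -
  obtain \<alpha> X where X: "0 \<le> \<alpha>" "\<alpha> \<le> pi / 2" "x = cos \<alpha> *\<^sub>R p + X" "X \<bullet> p = 0" "norm X = sin \<alpha>"
    using polar_coordinates assms by blast
  then show ?thesis
    using radial_dilation_polar[of \<alpha> p X 1] assms by (cases "sin \<alpha> = 0") simp_all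
qed

theorem theorem2:
  fixes C :: "ecomplex set" and c :: ecomplex and k :: real
  assumes "s_convex C"
    and "c \<in> C"
    and "C \<subseteq> closed_hemisphere c"
    and "0 < k" and "k \<le> 1"
  shows "s_convex (sdilation c k ` C)"
proof -
  define p where "p = unstereo c"
  have S: "arc_closed (unstereo ` C)" "unstereo ` C \<subseteq> sphere 0 1" "p \<in> unstereo ` C"
    using assms(1,2) by (auto simp: s_convex_iff_arc_closed p_def norm_unstereo)
  have hemi: "0 \<le> x \<bullet> p" if "x \<in> unstereo ` C" for x
  proof -
    from that obtain z where z: "z \<in> C" "x = unstereo z" by auto
    then have "0 \<le> cos (sdist c z)"
      using assms(3) sdist_range[of c z] by (intro cos_ge_zero) (auto simp: closed_hemisphere_def)
    then show ?thesis by (simp only: cos_sdist z p_def inner_commute)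
  qed
  have "unstereo ` sdilation c k ` C = radial_dilation p k ` unstereo ` C"
    unfolding image_image p_def using assms by (intro image_cong unstereo_sdilation) auto
  moreover have "arc_closed (radial_dilation p k ` unstereo ` C)"
  proof (cases "k = 1")
    case True
    have "radial_dilation p 1 ` unstereo ` C = id ` unstereo ` C"
      using hemi norm_unstereo by (intro image_cong) (auto simp: p_def intro!: radial_dilation_1)
    then show ?thesis using S True by simp
  next
    case False
    then show ?thesis using assms by (intro arc_closed_radial_dilation S hemi) auto
  qed
  ultimately show ?thesis by (simp add: s_convex_iff_arc_closed)
qed

end
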